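(* (i) Let $\{a_n\}$ be a $k$-periodic sequence of positive numbers with primitive period $k$. The recurrence $x_{n+2}=\frac{a_n+x_{n+1}}{x_n}$ has non-autonomous invariants of the form $V(x,y,n)=\Phi_n(x,y)/(xy)$, where $$\begin{aligned}\Phi_n(x,y)=\;&A_n+B_nx+C_ny+D_nx^2+F_ny^2+G_nx^3+H_nx^2y+I_nxy^2\\&+J_ny^3+K_nx^4+L_nx^3y+M_nx^2y^2+N_nxy^3+O_ny^4,\end{aligned}$$ if and only if $k\in\{1,2,3,6\}$. (ii) For positive $a,b,c,d,e,f$, the first integrals of the maps $F_a$, $F_{b,a}$, $F_{c,b,a}$ and $F_{f,e,d,c,b,a}$ (the cases $k=1,2,3,6$) corresponding to these invariants are, respectively, $$V_{a}(x,y)=\frac{a+(a+1)x+(a+1)y+x^2+y^2+x^2y+xy^2}{xy},$$ $$V_{b,a}(x,y)=\frac{ab+(a+b^2)x+(b+a^2)y+bx^2+ay^2+ax^2y+bxy^2}{xy},$$ $$V_{c,b,a}(x,y)=\frac{ac+(a+bc)x+(c+ab)y+bx^2+by^2+cx^2y+axy^2}{xy},$$ $$V_{f,e,d,c,b,a}(x,y)=\frac{af+(a+bf)x+(f+ae)y+bx^2+ey^2+cx^2y+dxy^2}{xy}.$$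
   Context: A non-autonomous invariant of the recurrence is a function $V(x,y,n)$ with $V(x_{n+1},x_{n+2},n+1)=V(x_n,x_{n+1},n)$ for all positive initial conditions and all $n\in\mathbb{N}$. The coefficients $A_n,\dots,O_n$ are sequences of nonnegative real numbers, and $\Phi_n$ is not identically zero. For positive $a$, $F_a(x,y)=\left(y,\frac{a+y}{x}\right)$ on $Q^+=\{(x,y):x>0,y>0\}$, and $F_{a_k,\dots,a_2,a_1}=F_{a_k}\circ\cdots\circ F_{a_2}\circ F_{a_1}$. A function $H$ is a first integral of a map $F$ if $H(F(x,y))=H(x,y)$. The first integral of $F_{a_k,\dots,a_1}$ corresponding to a $k$-periodic (in $n$) invariant $V(x,y,n)$ is $V(x,y,1)$, taken up to a nonzero constant factor.
   Formalization: "Only if" in (i) fails for some sequences (e.g. 1,2,2,2 repeated, k=4); it is stated as: for k not in {1,2,3,6} some sequence of primitive period k has no such invariant, and none does if a_{n+1} ≠ a_n a_{n+2} for all n; "if" holds for all sequences. *)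

theory Defs
  imports Complex_Main
begin

(* Sequences are indexed by n = 1, 2, 3, ...; the value at index 0 is never used. *)

definition periodic_seq :: "nat \<Rightarrow> (nat \<Rightarrow> 'a) \<Rightarrow> bool" where
  "periodic_seq k a \<longleftrightarrow> k \<ge> 1 \<and> (\<forall>n\<ge>1. a (n + k) = a n)"

definition primitive_period :: "nat \<Rightarrow> (nat \<Rightarrow> 'a) \<Rightarrow> bool" where
  "primitive_period k a \<longleftrightarrow> periodic_seq k a \<and> (\<forall>j. 1 \<le> j \<and> j < k \<longrightarrow> \<not> periodic_seq j a)"

definition positive_seq :: "(nat \<Rightarrow> real) \<Rightarrow> bool" where
  "positive_seq a \<longleftrightarrow> (\<forall>n\<ge>1. a n > 0)"

definition nonneg_seq :: "(nat \<Rightarrow> real) \<Rightarrow> bool" where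
  "nonneg_seq a \<longleftrightarrow> (\<forall>n\<ge>1. a n \<ge> 0)"

definition lyness_solution :: "(nat \<Rightarrow> real) \<Rightarrow> (nat \<Rightarrow> real) \<Rightarrow> bool" where
  "lyness_solution a x \<longleftrightarrow>
     x 1 > 0 \<and> x 2 > 0 \<and> (\<forall>n\<ge>1. x (n + 2) = (a n + x (n + 1)) / x n)"

definition nonautonomous_invariant ::
    "(nat \<Rightarrow> real) \<Rightarrow> (real \<Rightarrow> real \<Rightarrow> nat \<Rightarrow> real) \<Rightarrow> bool" where
  "nonautonomous_invariant a V \<longleftrightarrow>
     (\<forall>x. lyness_solution a x \<longrightarrow>
        (\<forall>n\<ge>1. V (x (n + 1)) (x (n + 2)) (n + 1) = V (x n) (x (n + 1)) n))"

(* V has the form Phi_n(x,y) / (xy) on the open positive quadrant. There is no xy term in Phi_n.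
   The coefficient of y^4 is called P because O is infix syntax (relation composition). *)
definition quartic_form :: "(real \<Rightarrow> real \<Rightarrow> nat \<Rightarrow> real) \<Rightarrow> bool" where
  "quartic_form V \<longleftrightarrow>
     (\<exists>A B C D F G H I J K L M N P :: nat \<Rightarrow> real. \<exists>\<Phi> :: nat \<Rightarrow> real \<Rightarrow> real \<Rightarrow> real.
        (\<forall>c \<in> {A, B, C, D, F, G, H, I, J, K, L, M, N, P}. nonneg_seq c) \<and>
        (\<forall>n x y. \<Phi> n x y =
            A n + B n * x + C n * y + D n * x^2 + F n * y^2
            + G n * x^3 + H n * x^2 * y + I n * x * y^2 + J n * y^3
            + K n * x^4 + L n * x^3 * y + M n * x^2 * y^2 + N n * x * y^3 + P n * y^4) \<and>
        (\<forall>n\<ge>1. \<exists>x y. \<Phi> n x y \<noteq> 0) \<and>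
        (\<forall>n\<ge>1. \<forall>x>0. \<forall>y>0. V x y n = \<Phi> n x y / (x * y)))"

definition quartic_invariant ::
    "(nat \<Rightarrow> real) \<Rightarrow> (real \<Rightarrow> real \<Rightarrow> nat \<Rightarrow> real) \<Rightarrow> bool" where
  "quartic_invariant a V \<longleftrightarrow> nonautonomous_invariant a V \<and> quartic_form V"

definition periodic_in_n :: "nat \<Rightarrow> (real \<Rightarrow> real \<Rightarrow> nat \<Rightarrow> real) \<Rightarrow> bool" where
  "periodic_in_n k V \<longleftrightarrow> (\<forall>x>0. \<forall>y>0. periodic_seq k (\<lambda>n. V x y n))"

definition lyness_map :: "real \<Rightarrow> real \<times> real \<Rightarrow> real \<times> real" where
  "lyness_map a = (\<lambda>(x, y). (y, (a + y) / x))"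

(* lyness_comp [a_k, ..., a_2, a_1] = F_{a_k} o ... o F_{a_2} o F_{a_1} *)
definition lyness_comp :: "real list \<Rightarrow> real \<times> real \<Rightarrow> real \<times> real" where
  "lyness_comp as = foldr (\<lambda>a g. lyness_map a \<circ> g) as id"

(* For as = [a_k, ..., a_2, a_1], the k-periodic sequence that starts a_1, a_2, ..., a_k at n = 1. *)
definition lyness_seq :: "real list \<Rightarrow> nat \<Rightarrow> real" where
  "lyness_seq as n = rev as ! ((n - 1) mod length as)"

definition first_integral ::
    "(real \<times> real \<Rightarrow> real \<times> real) \<Rightarrow> (real \<times> real \<Rightarrow> real) \<Rightarrow> bool" where
  "first_integral F W \<longleftrightarrow> (\<forall>x>0. \<forall>y>0. W (F (x, y)) = W (x, y))"

(* With as = [a_k, ..., a_1]: k-periodic invariants of the required form exist, and for each of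
   them V(x,y,1) is W up to a nonzero constant factor. *)
definition corresponding_first_integral :: "real list \<Rightarrow> (real \<times> real \<Rightarrow> real) \<Rightarrow> bool" where
  "corresponding_first_integral as W \<longleftrightarrow>
     first_integral (lyness_comp as) W \<and>
     (\<exists>V. quartic_invariant (lyness_seq as) V \<and> periodic_in_n (length as) V) \<and>
     (\<forall>V. quartic_invariant (lyness_seq as) V \<and> periodic_in_n (length as) V \<longrightarrow>
        (\<exists>c. c \<noteq> 0 \<and> (\<forall>x>0. \<forall>y>0. V x y 1 = c * W (x, y))))"

end

theory Submission
  imports Defs "HOL-Computational_Algebra.Polynomial"
begin

text \<open>
  Every point of the positive quadrant is reached at every time \<open>n\<close> by some solution, so invariance
  amounts to the one-step identities \<open>V(y, (a\<^sub>n + y)/x, n+1) = V(x, y, n)\<close> for all \<open>x, y > 0\<close>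
  (lemma \<open>nonautonomous_invariant_iff_step\<close>). For \<open>V = \<Phi>\<^sub>n/(xy)\<close> and \<open>w = a\<^sub>n + y\<close>, multiplying by a
  power of \<open>x\<close> gives a polynomial identity in \<open>x\<close> and \<open>y\<close>. Comparing coefficients at consecutive times
  kills the pure cubic terms and all quartic terms, and expresses what is left through the coefficients
  \<open>g\<^sub>n\<close> of \<open>x\<^sup>2\<close>: the coefficients of \<open>x\<^sup>2y\<close>, \<open>xy\<^sup>2\<close> and \<open>y\<^sup>2\<close> at time \<open>n\<close> are \<open>g\<^sub>n\<^sub>+\<^sub>1\<close>, \<open>g\<^sub>n\<^sub>+\<^sub>2\<close>
  and \<open>g\<^sub>n\<^sub>+\<^sub>3\<close>, and the remaining three are determined by \<open>g\<close> and \<open>a\<close>. Two relations survive,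
    \<open>a\<^sub>n\<^sub>+\<^sub>1 g\<^sub>n\<^sub>+\<^sub>5 = a\<^sub>n g\<^sub>n\<close>  and  \<open>g\<^sub>n\<^sub>+\<^sub>6 + a\<^sub>n\<^sub>+\<^sub>2 g\<^sub>n\<^sub>+\<^sub>5 = g\<^sub>n + a\<^sub>n g\<^sub>n\<^sub>+\<^sub>1\<close>
  (lemma \<open>quartic_invariant_imp_lyness_numerator\<close>), and they are also sufficient
  (lemma \<open>lyness_numerator_step\<close>).

  Eliminating \<open>g\<^sub>n\<^sub>+\<^sub>5\<close> and \<open>g\<^sub>n\<^sub>+\<^sub>6\<close> leaves
    \<open>(a\<^sub>n\<^sub>+\<^sub>1 - a\<^sub>n a\<^sub>n\<^sub>+\<^sub>2) (a\<^sub>n\<^sub>+\<^sub>2 g\<^sub>n - a\<^sub>n\<^sub>+\<^sub>1 g\<^sub>n\<^sub>+\<^sub>1) = 0\<close>.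
  If the first factor never vanishes, \<open>g\<^sub>n/a\<^sub>n\<^sub>+\<^sub>1\<close> is a constant \<open>c\<close>, which is not zero because
  \<open>\<Phi>\<^sub>n\<close> is not; the first relation then reads \<open>a\<^sub>n\<^sub>+\<^sub>6 = a\<^sub>n\<close>, so the primitive period divides 6.
  Conversely \<open>g\<^sub>n = a\<^sub>n\<^sub>+\<^sub>1\<close> solves both relations for each sequence of period 6, and the values
  2, ..., 2, 3 repeated form a sequence with any prescribed primitive period and nonvanishing first
  factors.

  When the first factor does vanish, a sequence can have more invariants, but not more of those that
  repeat after 6 steps: if \<open>g\<^sub>n\<^sub>+\<^sub>6 = g\<^sub>n\<close>, the first relation at \<open>n + 1\<close> alone is
  \<open>a\<^sub>n\<^sub>+\<^sub>2 g\<^sub>n = a\<^sub>n\<^sub>+\<^sub>1 g\<^sub>n\<^sub>+\<^sub>1\<close>. Hence the invariant with \<open>g\<^sub>n = a\<^sub>n\<^sub>+\<^sub>1\<close> is unique up to a factor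
  among those (lemma \<open>periodic_quartic_invariant_unique\<close>), and its value at time 1 is the first
  integral displayed for period 6. The integrals for the periods 1, 2 and 3 are specialisations of
  it, up to the factor \<open>a\<close> for period 1.
\<close>

section \<open>Invariance as a one-step identity\<close>

fun lyness_orbit :: "(nat \<Rightarrow> real) \<Rightarrow> real \<Rightarrow> real \<Rightarrow> nat \<Rightarrow> real" where
  "lyness_orbit a x y 0 = 0"
| "lyness_orbit a x y (Suc 0) = x"
| "lyness_orbit a x y (Suc (Suc 0)) = y"
| "lyness_orbit a x y (Suc (Suc (Suc n))) =
     (a (Suc n) + lyness_orbit a x y (Suc (Suc n))) / lyness_orbit a x y (Suc n)"

lemma lyness_solution_orbit:
  assumes "x > 0" and "y > 0"
  shows "lyness_solution a (lyness_orbit a x y)"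
proof -
  have "lyness_orbit a x y (n + 2) = (a n + lyness_orbit a x y (n + 1)) / lyness_orbit a x y n"
    if "n \<ge> 1" for n
    using that by (cases n) auto
  then show ?thesis
    using assms by (simp add: lyness_solution_def numeral_2_eq_2)
qed

text \<open>
  The step \<open>(x, y) \<mapsto> (y, (a + y)/x)\<close> is a bijection of the positive quadrant, with inverse
  \<open>(x, y) \<mapsto> ((a + x)/y, x)\<close>. So a solution through a given pair at time \<open>n + 1\<close> is one through its
  preimage at time \<open>n\<close>.
\<close>
lemma lyness_solution_through:
  assumes a: "positive_seq a" and "n \<ge> 1" and "x > 0" and "y > 0"
  shows "\<exists>s. lyness_solution a s \<and> s n = x \<and> s (n + 1) = y"
  using assms(2-4)
proof (induction n arbitrary: x y rule: dec_induct)
  case base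
  then show ?case
    using lyness_solution_orbit[of x y a] by (intro exI[of _ "lyness_orbit a x y"]) auto
next
  case (step n)
  have an: "a n > 0"
    using a step.hyps by (simp add: positive_seq_def)
  then have "(a n + x) / y > 0"
    using step.prems by simp
  from step.IH[OF this step.prems(1)] obtain s
    where s: "lyness_solution a s" "s n = (a n + x) / y" "s (n + 1) = x" by blast
  have "s (n + 2) = (a n + s (n + 1)) / s n"
    using s(1) step.hyps by (simp add: lyness_solution_def)
  then have "s (Suc n + 1) = y"
    using s an step.prems by simp
  then show ?case
    using s by auto
qed

lemma lyness_solution_positive:
  assumes a: "positive_seq a" and s: "lyness_solution a s" and "n \<ge> 1"
  shows "s n > 0 \<and> s (n + 1) > 0"
  using assms(3)
proof (induction n rule: dec_induct)
  case base
  then show ?case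
    using s by (simp add: lyness_solution_def numeral_2_eq_2)
next
  case (step n)
  have "s (n + 2) = (a n + s (n + 1)) / s n" and "a n > 0"
    using s a step.hyps by (auto simp: lyness_solution_def positive_seq_def)
  then show ?case
    using step.IH by simp
qed

lemma nonautonomous_invariant_iff_step:
  assumes a: "positive_seq a"
  shows "nonautonomous_invariant a V \<longleftrightarrow>
    (\<forall>n\<ge>1. \<forall>x>0. \<forall>y>0. V y ((a n + y) / x) (n + 1) = V x y n)"
proof
  assume inv: "nonautonomous_invariant a V"
  show "\<forall>n\<ge>1. \<forall>x>0. \<forall>y>0. V y ((a n + y) / x) (n + 1) = V x y n"
  proof (intro allI impI)
    fix n :: nat and x y :: real
    assume n: "1 \<le> n" and xy: "0 < x" "0 < y"
    obtain s where s: "lyness_solution a s" "s n = x" "s (n + 1) = y"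
      using lyness_solution_through[OF a n xy] by blast
    have "s (n + 2) = (a n + y) / x"
      using s n by (simp add: lyness_solution_def)
    moreover have "V (s (n + 1)) (s (n + 2)) (n + 1) = V (s n) (s (n + 1)) n"
      using inv s(1) n by (simp add: nonautonomous_invariant_def)
    ultimately show "V y ((a n + y) / x) (n + 1) = V x y n"
      using s by simp
  qed
next
  assume step: "\<forall>n\<ge>1. \<forall>x>0. \<forall>y>0. V y ((a n + y) / x) (n + 1) = V x y n"
  show "nonautonomous_invariant a V"
    unfolding nonautonomous_invariant_def
  proof (intro allI impI)
    fix s :: "nat \<Rightarrow> real" and n :: nat
    assume s: "lyness_solution a s" and n: "1 \<le> n"
    have "s (n + 2) = (a n + s (n + 1)) / s n"
      using s n by (simp add: lyness_solution_def)
    then show "V (s (n + 1)) (s (n + 2)) (n + 1) = V (s n) (s (n + 1)) n"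
      using step n lyness_solution_positive[OF a s n] by simp
  qed
qed

section \<open>Comparison of coefficients\<close>

lemma poly_eq_0_if_zero_on_positive:
  fixes p :: "real poly"
  assumes "\<And>x. x > 0 \<Longrightarrow> poly p x = 0"
  shows "p = 0"
proof (rule ccontr)
  assume "p \<noteq> 0"
  then have "finite {x. poly p x = 0}"
    by (rule poly_roots_finite)
  moreover have "{0<..} \<subseteq> {x. poly p x = 0}"
    using assms by auto
  ultimately show False
    using infinite_Ioi[of "0::real"] finite_subset by blast
qed

text \<open>
  One step of the invariance, read off coefficientwise; primes mark the coefficients at the next time.
  After multiplication by a power of \<open>x\<close> the identity is polynomial in \<open>x\<close> of degree 6, with
  coefficients that are polynomials in \<open>y\<close>. So the comparison is made first in \<open>x\<close> for each fixed
  \<open>y\<close>, and then in \<open>y\<close>.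
\<close>
lemma quartic_step_coefficients:
  fixes a :: real
  assumes "a > 0"
    and step: "\<And>x y. x > 0 \<Longrightarrow> y > 0 \<Longrightarrow>
      (A' + B' * y + C' * ((a + y) / x) + D' * y^2 + F' * ((a + y) / x)^2
        + G' * y^3 + H' * y^2 * ((a + y) / x) + I' * y * ((a + y) / x)^2 + J' * ((a + y) / x)^3
        + K' * y^4 + L' * y^3 * ((a + y) / x) + M' * y^2 * ((a + y) / x)^2
        + N' * y * ((a + y) / x)^3 + P' * ((a + y) / x)^4) / (y * ((a + y) / x))
      = (A + B * x + C * y + D * x^2 + F * y^2
        + G * x^3 + H * x^2 * y + I * x * y^2 + J * y^3
        + K * x^4 + L * x^3 * y + M * x^2 * y^2 + N * x * y^3 + P * y^4) / (x * y)"
  shows "A = a * F' \<and> C = F' + a * I' \<and> F = I' + a * M' \<and> J = M' \<and> P = 0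
    \<and> C' = B \<and> H' = I \<and> L' = N
    \<and> A' = a * D \<and> B' = D + a * H \<and> D' = H + a * M \<and> G' = M \<and> K' = 0
    \<and> G = 0 \<and> L = 0 \<and> K = 0"
proof -
  have eqs: "(a + y) * (F' + I' * y + M' * y^2) - (A + C * y + F * y^2 + J * y^3 + P * y^4) = 0
    \<and> C' + H' * y^2 + L' * y^3 - (B + I * y^2 + N * y^3) = 0
    \<and> A' + B' * y + D' * y^2 + G' * y^3 + K' * y^4 - (a + y) * (D + H * y + M * y^2) = 0
    \<and> G + L * y = 0 \<and> K = 0" if y: "y > 0" for y
  proof -
    define w where "w = a + y"
    have w: "w > 0"
      using assms(1) y by (simp add: w_def)
    \<comment> \<open>The coefficients in \<open>x\<close> of \<open>x\<^sup>4 \<Phi>'(y, w/x) - x\<^sup>2 w \<Phi>(x, y)\<close>. A power of \<open>w\<close> that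
      divides a coefficient stays factored out, so that \<open>w > 0\<close> cancels it.\<close>
    define p where "p = [: w^4 * P', w^3 * (J' + N' * y),
      w * (w * (F' + I' * y + M' * y^2) - (A + C * y + F * y^2 + J * y^3 + P * y^4)),
      w * (C' + H' * y^2 + L' * y^3 - (B + I * y^2 + N * y^3)),
      A' + B' * y + D' * y^2 + G' * y^3 + K' * y^4 - w * (D + H * y + M * y^2),
      - (w * (G + L * y)), - (w * K) :]"
    have "poly p x = 0" if x: "x > 0" for x
    proof -
      define v where "v = w / x"
      have v: "v > 0" "w = v * x"
        using w x by (simp_all add: v_def)
      define S where "S = A' + B' * y + C' * v + D' * y^2 + F' * v^2
        + G' * y^3 + H' * y^2 * v + I' * y * v^2 + J' * v^3
        + K' * y^4 + L' * y^3 * v + M' * y^2 * v^2 + N' * y * v^3 + P' * v^4"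
      define T where "T = A + B * x + C * y + D * x^2 + F * y^2
        + G * x^3 + H * x^2 * y + I * x * y^2 + J * y^3
        + K * x^4 + L * x^3 * y + M * x^2 * y^2 + N * x * y^3 + P * y^4"
      have "S / (y * v) = T / (x * y)"
        using step[OF x y] unfolding S_def T_def v_def w_def .
      then have "x * S - v * T = 0"
        using x y v(1) by (simp add: field_simps)
      moreover have "poly p x = x^3 * (x * S - v * T)"
        unfolding p_def v(2) S_def T_def poly_pCons poly_0 by algebra
      ultimately show ?thesis by simp
    qed
    then have "p = 0"
      by (rule poly_eq_0_if_zero_on_positive)
    then show ?thesis
      using w unfolding p_def w_def by simp
  qed
  have "[: A - a * F', C - (F' + a * I'), F - (I' + a * M'), J - M', P :] = 0"
    using eqs by (intro poly_eq_0_if_zero_on_positive) (simp add: algebra_simps power_numeral_reduce)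
  moreover have "[: C' - B, 0, H' - I, L' - N :] = 0"
    using eqs by (intro poly_eq_0_if_zero_on_positive) (simp add: algebra_simps power_numeral_reduce)
  moreover have "[: A' - a * D, B' - (D + a * H), D' - (H + a * M), G' - M, K' :] = 0"
    using eqs by (intro poly_eq_0_if_zero_on_positive) (simp add: algebra_simps power_numeral_reduce)
  moreover have "[: G, L :] = 0"
    using eqs by (intro poly_eq_0_if_zero_on_positive) (simp add: algebra_simps)
  moreover have "K = 0"
    using eqs[of 1] by simp
  ultimately show ?thesis by simp
qed

text \<open>
  The shape to which the coefficient relations reduce \<open>\<Phi>\<^sub>n\<close>, with \<open>g\<close> the sequence of coefficients of
  \<open>x\<^sup>2\<close>.
\<close>
definition lyness_numerator ::
    "(nat \<Rightarrow> real) \<Rightarrow> (nat \<Rightarrow> real) \<Rightarrow> nat \<Rightarrow> real \<Rightarrow> real \<Rightarrow> real" where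
  "lyness_numerator a g n x y =
     a n * g (n + 4) + (g (n + 5) + a (n + 1) * g (n + 4)) * x + (g (n + 4) + a n * g (n + 3)) * y
     + g n * x^2 + g (n + 3) * y^2 + g (n + 1) * x^2 * y + g (n + 2) * x * y^2"

text \<open>
  The first equation makes the two descriptions of the constant coefficient at time \<open>n + 1\<close> agree:
  \<open>a\<^sub>n\<^sub>+\<^sub>1 g\<^sub>n\<^sub>+\<^sub>5\<close>, from the step that leaves this time, and \<open>a\<^sub>n g\<^sub>n\<close>, from the step that reaches it.
  The second equation does the same for the coefficient of \<open>x\<close>.
\<close>
definition compatible :: "(nat \<Rightarrow> real) \<Rightarrow> (nat \<Rightarrow> real) \<Rightarrow> bool" where
  "compatible a g \<longleftrightarrow> (\<forall>n\<ge>1. a (n + 1) * g (n + 5) = a n * g n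
     \<and> g (n + 6) + a (n + 2) * g (n + 5) = g n + a n * g (n + 1))"

text \<open>
  With \<open>v = (a\<^sub>n + y)/x\<close> the claim is \<open>x \<Phi>\<^sub>n\<^sub>+\<^sub>1(y, v) = v \<Phi>\<^sub>n(x, y)\<close>. Compatibility rewrites the first
  two coefficients of \<open>\<Phi>\<^sub>n\<^sub>+\<^sub>1\<close> so that both sides involve only \<open>g\<^sub>n, ..., g\<^sub>n\<^sub>+\<^sub>5\<close>, and the substitution
  \<open>a\<^sub>n = vx - y\<close> turns the claim into a polynomial identity.
\<close>
lemma lyness_numerator_step:
  assumes "compatible a g" and "n \<ge> 1" and "a n > 0" and "x > 0" and "y > 0"
  shows "lyness_numerator a g (n + 1) y ((a n + y) / x) / (y * ((a n + y) / x))
    = lyness_numerator a g n x y / (x * y)"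
proof -
  define v where "v = (a n + y) / x"
  have v: "v > 0" "a n = v * x - y"
    using assms by (simp_all add: v_def)
  have eqs: "a (n + 1) * g (n + 5) = a n * g n"
      "g (n + 6) + a (n + 2) * g (n + 5) = g n + a n * g (n + 1)"
    using assms by (auto simp: compatible_def)
  have "lyness_numerator a g (n + 1) y v = a (n + 1) * g (n + 5)
     + (g (n + 6) + a (n + 2) * g (n + 5)) * y + (g (n + 5) + a (n + 1) * g (n + 4)) * v
     + g (n + 1) * y^2 + g (n + 4) * v^2 + g (n + 2) * y^2 * v + g (n + 3) * y * v^2"
    by (simp add: lyness_numerator_def numeral_eq_Suc)
  also have "x * \<dots> = v * lyness_numerator a g n x y"
    unfolding eqs lyness_numerator_def v(2)
    by (simp add: algebra_simps power2_eq_square)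
  finally have "x * lyness_numerator a g (n + 1) y v = v * lyness_numerator a g n x y" .
  then show ?thesis
    using v(1) assms(4,5) unfolding v_def[symmetric] by (simp add: field_simps)
qed

text \<open>
  Each relation between times \<open>n\<close> and \<open>n + 1\<close> holds for all \<open>n \<ge> 1\<close>, and the relations chain. For
  instance \<open>M\<^sub>n = G\<^sub>n\<^sub>+\<^sub>1 = 0\<close>, hence also \<open>J\<^sub>n = M\<^sub>n\<^sub>+\<^sub>1 = 0\<close>. With \<open>M = 0\<close>, the chain
  \<open>F\<^sub>n = I\<^sub>n\<^sub>+\<^sub>1 = H\<^sub>n\<^sub>+\<^sub>2 = D\<^sub>n\<^sub>+\<^sub>3\<close> leads to the coefficients \<open>D\<close> of \<open>x\<^sup>2\<close>, which serve as \<open>g\<close>.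
\<close>
lemma quartic_invariant_imp_lyness_numerator:
  assumes a: "positive_seq a" and V: "quartic_invariant a V"
  obtains g where "compatible a g"
    and "\<And>n x y. n \<ge> 1 \<Longrightarrow> x > 0 \<Longrightarrow> y > 0 \<Longrightarrow> V x y n = lyness_numerator a g n x y / (x * y)"
    and "\<And>n. n \<ge> 1 \<Longrightarrow> \<exists>x y. lyness_numerator a g n x y \<noteq> 0"
proof -
  from V obtain A B C D F G H I J K L M N P :: "nat \<Rightarrow> real" and \<Phi> :: "nat \<Rightarrow> real \<Rightarrow> real \<Rightarrow> real"
    where \<Phi>: "\<forall>n x y. \<Phi> n x y =
            A n + B n * x + C n * y + D n * x^2 + F n * y^2
            + G n * x^3 + H n * x^2 * y + I n * x * y^2 + J n * y^3
            + K n * x^4 + L n * x^3 * y + M n * x^2 * y^2 + N n * x * y^3 + P n * y^4"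
      and nz: "\<forall>n\<ge>1. \<exists>x y. \<Phi> n x y \<noteq> 0"
      and V\<Phi>: "\<forall>n\<ge>1. \<forall>x>0. \<forall>y>0. V x y n = \<Phi> n x y / (x * y)"
    unfolding quartic_invariant_def quartic_form_def by (elim conjE exE) (rule that)
  note \<Phi> = \<Phi>[rule_format] and nz = nz[rule_format] and V\<Phi> = V\<Phi>[rule_format]
  have inv: "V y ((a n + y) / x) (n + 1) = V x y n" if "n \<ge> 1" "x > 0" "y > 0" for n x y
    using V that nonautonomous_invariant_iff_step[OF a] by (simp add: quartic_invariant_def)
  have rel: "A n = a n * F (n+1) \<and> C n = F (n+1) + a n * I (n+1) \<and> F n = I (n+1) + a n * M (n+1)
      \<and> J n = M (n+1) \<and> P n = 0 \<and> C (n+1) = B n \<and> H (n+1) = I n \<and> L (n+1) = N n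
      \<and> A (n+1) = a n * D n \<and> B (n+1) = D n + a n * H n \<and> D (n+1) = H n + a n * M n
      \<and> G (n+1) = M n \<and> K (n+1) = 0 \<and> G n = 0 \<and> L n = 0 \<and> K n = 0"
    if n: "n \<ge> 1" for n
  proof (rule quartic_step_coefficients)
    show an: "a n > 0"
      using a n by (simp add: positive_seq_def)
    fix x y :: real
    assume xy: "x > 0" "y > 0"
    have "\<Phi> (n + 1) y ((a n + y) / x) / (y * ((a n + y) / x)) = \<Phi> n x y / (x * y)"
      using inv[OF n xy] V\<Phi>[OF n xy] V\<Phi>[of "n + 1" y "(a n + y) / x"] xy an by simp
    then show "(A (n+1) + B (n+1) * y + C (n+1) * ((a n + y) / x) + D (n+1) * y^2
        + F (n+1) * ((a n + y) / x)^2 + G (n+1) * y^3 + H (n+1) * y^2 * ((a n + y) / x)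
        + I (n+1) * y * ((a n + y) / x)^2 + J (n+1) * ((a n + y) / x)^3 + K (n+1) * y^4
        + L (n+1) * y^3 * ((a n + y) / x) + M (n+1) * y^2 * ((a n + y) / x)^2
        + N (n+1) * y * ((a n + y) / x)^3 + P (n+1) * ((a n + y) / x)^4) / (y * ((a n + y) / x))
      = (A n + B n * x + C n * y + D n * x^2 + F n * y^2
        + G n * x^3 + H n * x^2 * y + I n * x * y^2 + J n * y^3
        + K n * x^4 + L n * x^3 * y + M n * x^2 * y^2 + N n * x * y^3 + P n * y^4) / (x * y)"
      unfolding \<Phi> .
  qed
  \<comment> \<open>The longest chain, \<open>J\<^sub>n = M\<^sub>n\<^sub>+\<^sub>1 = G\<^sub>n\<^sub>+\<^sub>2 = 0\<close>, reaches up to time \<open>n + 2\<close>.\<close>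
  have high: "G n = 0 \<and> J n = 0 \<and> K n = 0 \<and> L n = 0 \<and> M n = 0 \<and> N n = 0 \<and> P n = 0"
    if "n \<ge> 1" for n
    using rel[of n] rel[of "n + 1"] rel[of "n + 2"] that by (simp add: add.assoc)
  have H: "H n = D (n + 1)" if "n \<ge> 1" for n
    using rel[OF that] high[OF that] by simp
  have I: "I n = D (n + 2)" if "n \<ge> 1" for n
    using rel[OF that] H[of "n + 1"] by simp
  have F: "F n = D (n + 3)" if "n \<ge> 1" for n
    using rel[OF that] high[of "n + 1"] I[of "n + 1"] by (simp add: numeral_eq_Suc)
  have A: "A n = a n * D (n + 4)" if "n \<ge> 1" for n
    using rel[OF that] F[of "n + 1"] by (simp add: numeral_eq_Suc)
  have C: "C n = D (n + 4) + a n * D (n + 3)" if "n \<ge> 1" for n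
    using rel[OF that] F[of "n + 1"] I[of "n + 1"] by (simp add: numeral_eq_Suc)
  have B: "B n = D (n + 5) + a (n + 1) * D (n + 4)" if "n \<ge> 1" for n
    using rel[OF that] C[of "n + 1"] by (simp add: numeral_eq_Suc)
  have \<Phi>_eq: "\<Phi> n x y = lyness_numerator a D n x y" if "n \<ge> 1" for n x y
    unfolding \<Phi> lyness_numerator_def
    using A[OF that] B[OF that] C[OF that] F[OF that] H[OF that] I[OF that] high[OF that] by (simp add: numeral_eq_Suc)
  have "compatible a D"
    unfolding compatible_def
  proof (intro allI impI conjI)
    fix n :: nat
    assume n: "1 \<le> n"
    show "a (n + 1) * D (n + 5) = a n * D n"
      using rel[OF n] A[of "n + 1"] by (simp add: numeral_eq_Suc)
    show "D (n + 6) + a (n + 2) * D (n + 5) = D n + a n * D (n + 1)"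
      using rel[OF n] B[of "n + 1"] H[OF n] by (simp add: numeral_eq_Suc)
  qed
  then show thesis
    using that[of D] V\<Phi> \<Phi>_eq nz by simp
qed

section \<open>Solutions of the coefficient relations\<close>

lemma ratio_recurrence_imp_proportional:
  assumes a: "positive_seq a"
    and ratio: "\<And>n. n \<ge> 1 \<Longrightarrow> a (n + 2) * g n = a (n + 1) * g (n + 1)"
  obtains c where "\<And>n. n \<ge> 1 \<Longrightarrow> g n = c * a (n + 1)"
proof -
  have pos: "a n > 0" if "n \<ge> 1" for n
    using a that by (simp add: positive_seq_def)
  have "g n = g 1 / a 2 * a (n + 1)" if "n \<ge> 1" for n
    using that
  proof (induction n rule: dec_induct)
    case base
    then show ?case
      using pos[of 2] by (simp add: numeral_2_eq_2)
  next
    case (step n)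
    have "a (n + 1) > 0"
      using pos by simp
    then have "g (Suc n) = a (n + 2) * g n / a (n + 1)"
      using ratio[OF step.hyps(1)] by (simp add: field_simps)
    then show ?case
      using step.IH \<open>a (n + 1) > 0\<close> by (simp add: mult.commute)
  qed
  then show thesis
    using that by blast
qed

text \<open>
  Eliminate \<open>g\<^sub>n\<^sub>+\<^sub>5\<close> and \<open>g\<^sub>n\<^sub>+\<^sub>6\<close> from the second relation by the first one, taken at \<open>n\<close> and at
  \<open>n + 1\<close>.
\<close>
lemma compatible_generic_ratio:
  assumes a: "positive_seq a" and g: "compatible a g" and n: "n \<ge> 1"
    and generic: "a (n + 1) \<noteq> a n * a (n + 2)"
  shows "a (n + 2) * g n = a (n + 1) * g (n + 1)"
proof -
  have pos: "a (n + 1) > 0" "a (n + 2) > 0"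
    using a by (simp_all add: positive_seq_def)
  have e1: "a (n + 1) * g (n + 5) = a n * g n"
    and e2: "g (n + 6) + a (n + 2) * g (n + 5) = g n + a n * g (n + 1)"
    using g n by (auto simp: compatible_def)
  have "a (n + 1 + 1) * g (n + 1 + 5) = a (n + 1) * g (n + 1)"
    using g unfolding compatible_def by (meson le_add2)
  then have e3: "a (n + 2) * g (n + 6) = a (n + 1) * g (n + 1)"
    by (simp add: numeral_eq_Suc)
  have "(a (n + 1) - a n * a (n + 2)) * (a (n + 2) * g n - a (n + 1) * g (n + 1)) = 0"
    using e1 e2 e3 by algebra
  then show ?thesis
    using generic by simp
qed

lemma compatible_proportional_imp_period_6:
  assumes a: "positive_seq a" and g: "compatible a g"
    and c: "\<And>n. n \<ge> 1 \<Longrightarrow> g n = c * a (n + 1)" and "c \<noteq> 0"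
  shows "periodic_seq 6 a"
  unfolding periodic_seq_def
proof (intro conjI allI impI)
  fix n :: nat
  assume n: "1 \<le> n"
  have "a (n + 1) * g (n + 5) = a n * g n"
    using g n by (simp add: compatible_def)
  moreover have "g (n + 5) = c * a (n + 6)"
    using c[of "n + 5"] by (simp add: numeral_eq_Suc)
  moreover have "g n = c * a (n + 1)"
    using c n by simp
  moreover have "a (n + 1) > 0"
    using a by (simp add: positive_seq_def)
  ultimately show "a (n + 6) = a n"
    using \<open>c \<noteq> 0\<close> by simp
qed simp

lemma lyness_numerator_scale:
  assumes g: "\<And>n. n \<ge> 1 \<Longrightarrow> g n = c * a (n + 1)" and n: "n \<ge> 1"
  shows "lyness_numerator a g n x y = c * lyness_numerator a (\<lambda>m. a (m + 1)) n x y"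
proof -
  have "g (n + i) = c * a (n + i + 1)" for i
    using g n by simp
  then show ?thesis
    unfolding lyness_numerator_def using g[OF n] by (simp only: ring_distribs mult.assoc mult.left_commute)
qed

lemma compatible_shift:
  assumes "periodic_seq 6 a"
  shows "compatible a (\<lambda>m. a (m + 1))"
  unfolding compatible_def
proof (intro allI impI)
  fix n :: nat
  assume n: "1 \<le> n"
  have "a (n + 6) = a n" and "a (n + 1 + 6) = a (n + 1)"
    using assms n unfolding periodic_seq_def by (metis le_add2)+
  then show "a (n + 1) * a (n + 5 + 1) = a n * a (n + 1)
     \<and> a (n + 6 + 1) + a (n + 2) * a (n + 5 + 1) = a (n + 1) + a n * a (n + 1 + 1)"
    by (simp add: numeral_eq_Suc)
qed

section \<open>Existence, necessity and uniqueness\<close>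

definition lyness_invariant :: "(nat \<Rightarrow> real) \<Rightarrow> real \<Rightarrow> real \<Rightarrow> nat \<Rightarrow> real" where
  "lyness_invariant a x y n = lyness_numerator a (\<lambda>m. a (m + 1)) n x y / (x * y)"

lemma quartic_invariant_lyness_invariant:
  assumes a: "positive_seq a" and per: "periodic_seq 6 a"
  shows "quartic_invariant a (lyness_invariant a)"
  unfolding quartic_invariant_def
proof
  show "nonautonomous_invariant a (lyness_invariant a)"
    unfolding nonautonomous_invariant_iff_step[OF a] lyness_invariant_def
    using lyness_numerator_step[OF compatible_shift[OF per]] a
    by (simp add: positive_seq_def)
  have pos: "a n > 0" if "n \<ge> 1" for n
    using a that by (simp add: positive_seq_def)
  have nonneg: "a n \<ge> 0" if "n \<ge> 1" for n
    using pos[OF that] by simp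
  define \<Phi> where "\<Phi> = (\<lambda>n. lyness_numerator a (\<lambda>m. a (m + 1)) n)"
  show "quartic_form (lyness_invariant a)"
    unfolding quartic_form_def
  proof (intro exI conjI)
    let ?A = "\<lambda>n. a n * a (n + 5)"
    let ?B = "\<lambda>n. a (n + 6) + a (n + 1) * a (n + 5)"
    let ?C = "\<lambda>n. a (n + 5) + a n * a (n + 4)"
    let ?Z = "\<lambda>n :: nat. 0 :: real"
    show "\<forall>c\<in>{?A, ?B, ?C, \<lambda>n. a (n + 1), \<lambda>n. a (n + 4), ?Z, \<lambda>n. a (n + 2), \<lambda>n. a (n + 3),
        ?Z, ?Z, ?Z, ?Z, ?Z, ?Z}. nonneg_seq c"
      using nonneg by (simp add: nonneg_seq_def)
    show "\<forall>n x y. \<Phi> n x y = ?A n + ?B n * x + ?C n * y + a (n + 1) * x^2 + a (n + 4) * y^2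
            + ?Z n * x^3 + a (n + 2) * x^2 * y + a (n + 3) * x * y^2 + ?Z n * y^3
            + ?Z n * x^4 + ?Z n * x^3 * y + ?Z n * x^2 * y^2 + ?Z n * x * y^3 + ?Z n * y^4"
      by (simp add: \<Phi>_def lyness_numerator_def numeral_eq_Suc)
    show "\<forall>n\<ge>1. \<exists>x y. \<Phi> n x y \<noteq> 0"
    proof (intro allI impI)
      fix n :: nat
      assume n: "1 \<le> n"
      have "\<Phi> n 0 0 > 0"
        using pos n by (simp add: \<Phi>_def lyness_numerator_def)
      then show "\<exists>x y. \<Phi> n x y \<noteq> 0"
        by (metis less_irrefl)
    qed
    show "\<forall>n\<ge>1. \<forall>x>0. \<forall>y>0. lyness_invariant a x y n = \<Phi> n x y / (x * y)"
      by (simp add: lyness_invariant_def \<Phi>_def)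
  qed
qed

lemma quartic_invariant_generic_imp_period_6:
  assumes a: "positive_seq a" and generic: "\<forall>n\<ge>1. a (n + 1) \<noteq> a n * a (n + 2)"
    and V: "quartic_invariant a V"
  shows "periodic_seq 6 a"
proof -
  obtain g where g: "compatible a g"
    and nz: "\<And>n. n \<ge> 1 \<Longrightarrow> \<exists>x y. lyness_numerator a g n x y \<noteq> 0"
    using quartic_invariant_imp_lyness_numerator[OF a V] by metis
  obtain c where c: "\<And>n. n \<ge> 1 \<Longrightarrow> g n = c * a (n + 1)"
    using ratio_recurrence_imp_proportional[OF a] compatible_generic_ratio[OF a g] generic by metis
  have "c \<noteq> 0"
    using nz[of 1] lyness_numerator_scale[of g c a 1, OF c] by auto
  then show ?thesis
    using compatible_proportional_imp_period_6[OF a g c] by blast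
qed

text \<open>
  Transfers periodicity from the invariant to its coefficients of \<open>x\<^sup>2\<close>: as a polynomial in \<open>x\<close>, the
  numerator at time \<open>n\<close> has leading coefficient \<open>g\<^sub>n + g\<^sub>n\<^sub>+\<^sub>1 y\<close>.
\<close>
lemma lyness_numerator_eq_imp_coefficient_eq:
  assumes "\<And>x y. x > 0 \<Longrightarrow> y > 0 \<Longrightarrow>
      lyness_numerator a g m x y / (x * y) = lyness_numerator a g n x y / (x * y)"
  shows "g m = g n"
proof -
  have "(g m - g n) + (g (m + 1) - g (n + 1)) * y = 0" if y: "y > 0" for y
  proof -
    \<comment> \<open>The coefficients of \<open>x\<^sup>0\<close> and \<open>x\<^sup>1\<close> in the numerator at time \<open>k\<close>.\<close>
    let ?c = "\<lambda>k. a k * g (k + 4) + (g (k + 4) + a k * g (k + 3)) * y + g (k + 3) * y^2"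
    let ?d = "\<lambda>k. g (k + 5) + a (k + 1) * g (k + 4) + g (k + 2) * y^2"
    have "poly [: ?c m - ?c n, ?d m - ?d n, (g m - g n) + (g (m + 1) - g (n + 1)) * y :] x = 0"
      if x: "x > 0" for x
    proof -
      have "lyness_numerator a g m x y = lyness_numerator a g n x y"
        using assms[OF x y] x y by simp
      then show ?thesis
        by (simp add: lyness_numerator_def algebra_simps power2_eq_square)
    qed
    then have "[: ?c m - ?c n, ?d m - ?d n, (g m - g n) + (g (m + 1) - g (n + 1)) * y :] = 0"
      by (rule poly_eq_0_if_zero_on_positive)
    then show ?thesis by simp
  qed
  then have "[: g m - g n, g (m + 1) - g (n + 1) :] = 0"
    by (intro poly_eq_0_if_zero_on_positive) (simp add: algebra_simps)
  then show ?thesis by simp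
qed

text \<open>
  Period 6 of the invariant replaces the genericity of the sequence: the first relation at \<open>n + 1\<close>,
  with \<open>g\<^sub>n\<^sub>+\<^sub>6\<close> replaced by \<open>g\<^sub>n\<close>, already says that \<open>g\<^sub>n/a\<^sub>n\<^sub>+\<^sub>1\<close> is constant.
\<close>
lemma periodic_quartic_invariant_unique:
  assumes a: "positive_seq a"
    and V: "quartic_invariant a V" and V6: "periodic_in_n 6 V"
  shows "\<exists>c. c \<noteq> 0 \<and> (\<forall>n\<ge>1. \<forall>x>0. \<forall>y>0. V x y n = c * lyness_invariant a x y n)"
proof -
  obtain g where g: "compatible a g"
    and Vg: "\<And>n x y. n \<ge> 1 \<Longrightarrow> x > 0 \<Longrightarrow> y > 0 \<Longrightarrow> V x y n = lyness_numerator a g n x y / (x * y)"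
    and nz: "\<And>n. n \<ge> 1 \<Longrightarrow> \<exists>x y. lyness_numerator a g n x y \<noteq> 0"
    using quartic_invariant_imp_lyness_numerator[OF a V] by metis
  have g6: "g (n + 6) = g n" if n: "n \<ge> 1" for n
  proof (rule lyness_numerator_eq_imp_coefficient_eq)
    fix x y :: real
    assume xy: "x > 0" "y > 0"
    have "V x y (n + 6) = V x y n"
      using V6 xy n by (simp add: periodic_in_n_def periodic_seq_def)
    then show "lyness_numerator a g (n + 6) x y / (x * y) = lyness_numerator a g n x y / (x * y)"
      using Vg[OF n xy] Vg[of "n + 6", OF _ xy] n by simp
  qed
  have "a (n + 2) * g n = a (n + 1) * g (n + 1)" if n: "n \<ge> 1" for n
  proof -
    have "a (n + 1 + 1) * g (n + 1 + 5) = a (n + 1) * g (n + 1)"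
      using g unfolding compatible_def by (meson le_add2)
    then show ?thesis
      using g6[OF n] by (simp add: numeral_eq_Suc)
  qed
  then obtain c where c: "\<And>n. n \<ge> 1 \<Longrightarrow> g n = c * a (n + 1)"
    using ratio_recurrence_imp_proportional[OF a] by metis
  have "c \<noteq> 0"
    using nz[of 1] lyness_numerator_scale[of g c a 1, OF c] by auto
  moreover have "V x y n = c * lyness_invariant a x y n" if "n \<ge> 1" "x > 0" "y > 0" for n x y
    using Vg[OF that] lyness_numerator_scale[of g c a n, OF c that(1)]
    by (simp add: lyness_invariant_def)
  ultimately show ?thesis by blast
qed

section \<open>Periods\<close>

lemma periodic_seq_dvd:
  assumes "periodic_seq k a" and "k dvd m" and "m \<ge> 1"
  shows "periodic_seq m a"
proof -
  obtain j where j: "m = k * j"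
    using assms(2) by blast
  have "a (n + k * i) = a n" if "n \<ge> 1" for n i
  proof (induction i)
    case (Suc i)
    have "a (n + k * i + k) = a (n + k * i)"
      using assms(1) that unfolding periodic_seq_def by (meson trans_le_add1)
    then show ?case
      using Suc.IH by (simp add: ac_simps)
  qed simp
  then show ?thesis
    using assms(3) j by (simp add: periodic_seq_def)
qed

text \<open>
  The periods 4 and 5 drop out since, combined with period 6, they would give the smaller periods
  2 and 1.
\<close>
lemma primitive_period_of_6_periodic:
  assumes k: "primitive_period k a" and per: "periodic_seq 6 a"
  shows "k \<in> {1, 2, 3, 6}"
proof -
  have pk: "k \<ge> 1" "\<And>n. n \<ge> 1 \<Longrightarrow> a (n + k) = a n"
    using k by (auto simp: primitive_period_def periodic_seq_def)
  have p6: "a (n + 6) = a n" if "n \<ge> 1" for n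
    using per that by (simp add: periodic_seq_def)
  have min: "\<not> periodic_seq j a" if "1 \<le> j" "j < k" for j
    using k that by (simp add: primitive_period_def)
  have "k \<le> 6"
    using min[of 6] per by force
  moreover have "k \<noteq> 4"
  proof
    assume "k = 4"
    have "a (n + 2) = a n" if "n \<ge> 1" for n
      using pk(2)[of "n + 2"] p6[OF that] \<open>k = 4\<close> by (simp add: numeral_eq_Suc)
    then show False
      using min[of 2] \<open>k = 4\<close> by (simp add: periodic_seq_def)
  qed
  moreover have "k \<noteq> 5"
  proof
    assume "k = 5"
    have "a (n + 1) = a n" if "n \<ge> 1" for n
      using pk(2)[of "n + 1"] p6[OF that] \<open>k = 5\<close> by (simp add: numeral_eq_Suc)
    then show False
      using min[of 1] \<open>k = 5\<close> by (simp add: periodic_seq_def)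
  qed
  ultimately show ?thesis
    using pk(1) by auto
qed

text \<open>
  If all values are 2 or 3, a product of two of them is at least 4, so it never equals a third.
\<close>
lemma exists_generic_primitive_period:
  assumes "k \<ge> 1"
  obtains a :: "nat \<Rightarrow> real" where "positive_seq a" and "primitive_period k a"
    and "\<forall>n\<ge>1. a (n + 1) \<noteq> a n * a (n + 2)"
proof
  define a :: "nat \<Rightarrow> real" where "a = (\<lambda>n. if k dvd n then 3 else 2)"
  show "positive_seq a"
    by (simp add: positive_seq_def a_def)
  show "primitive_period k a"
    unfolding primitive_period_def
  proof (intro conjI allI impI)
    show "periodic_seq k a"
      using assms by (simp add: periodic_seq_def a_def)
    fix j :: nat
    assume j: "1 \<le> j \<and> j < k"
    then have "\<not> k dvd j"
      by (auto dest: dvd_imp_le)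
    then have "a (k + j) \<noteq> a k"
      by (simp add: a_def)
    then show "\<not> periodic_seq j a"
      using assms by (auto simp: periodic_seq_def)
  qed
  show "\<forall>n\<ge>1. a (n + 1) \<noteq> a n * a (n + 2)"
    by (simp add: a_def)
qed

section \<open>First integrals of the composed maps\<close>

lemma lyness_comp_transports_invariant:
  assumes a: "positive_seq a" and V: "nonautonomous_invariant a V" and "x > 0" and "y > 0"
  shows "\<exists>x' y'. lyness_comp (rev (map a [1..<Suc k])) (x, y) = (x', y')
    \<and> x' > 0 \<and> y' > 0 \<and> V x' y' (k + 1) = V x y 1"
proof (induction k)
  case 0
  then show ?case
    using assms by (simp add: lyness_comp_def)
next
  case (Suc k)
  then obtain x' y' where IH: "lyness_comp (rev (map a [1..<Suc k])) (x, y) = (x', y')"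
    "x' > 0" "y' > 0" "V x' y' (k + 1) = V x y 1" by blast
  have "a (k + 1) > 0"
    using a by (simp add: positive_seq_def)
  then have "(a (k + 1) + y') / x' > 0"
    using IH by simp
  moreover have "V y' ((a (k + 1) + y') / x') (k + 1 + 1) = V x' y' (k + 1)"
    using V IH(2,3) unfolding nonautonomous_invariant_iff_step[OF a] by (meson le_add2)
  moreover have "lyness_comp (rev (map a [1..<Suc (Suc k)])) (x, y)
      = (y', (a (k + 1) + y') / x')"
    using IH(1) by (simp add: lyness_comp_def lyness_map_def)
  ultimately show ?case
    using IH by simp
qed

lemma first_integral_of_periodic_invariant:
  assumes "positive_seq (lyness_seq as)" and "nonautonomous_invariant (lyness_seq as) V"
    and per: "periodic_in_n (length as) V"
    and W: "\<And>x y. x > 0 \<Longrightarrow> y > 0 \<Longrightarrow> V x y 1 = r * W (x, y)" and "r \<noteq> 0"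
  shows "first_integral (lyness_comp as) W"
  unfolding first_integral_def
proof (intro allI impI)
  fix x y :: real
  assume xy: "0 < x" "0 < y"
  have "rev as = map (lyness_seq as) [1..<Suc (length as)]"
    by (rule nth_equalityI) (auto simp: lyness_seq_def nth_upt simp del: upt_Suc)
  then have "as = rev (map (lyness_seq as) [1..<Suc (length as)])"
    by (metis rev_rev_ident)
  then obtain x' y' where *: "lyness_comp as (x, y) = (x', y')" "x' > 0" "y' > 0"
    "V x' y' (length as + 1) = V x y 1"
    using lyness_comp_transports_invariant[OF assms(1,2) xy, of "length as"] by metis
  have "V x' y' (1 + length as) = V x' y' 1"
    using per *(2,3) unfolding periodic_in_n_def periodic_seq_def by blast
  then have "r * W (x', y') = r * W (x, y)"
    using *(4) W[OF xy] W[OF *(2,3)] by (metis add.commute)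
  then show "W (lyness_comp as (x, y)) = W (x, y)"
    using \<open>r \<noteq> 0\<close> *(1) by auto
qed

lemma periodic_seq_lyness_seq:
  assumes "as \<noteq> []"
  shows "periodic_seq (length as) (lyness_seq as)"
proof -
  have "(n + length as - 1) mod length as = (n - 1) mod length as" if "n \<ge> 1" for n
    using that by (metis Nat.add_diff_assoc2 mod_add_self2)
  then show ?thesis
    using assms by (simp add: periodic_seq_def lyness_seq_def Suc_le_eq)
qed

lemma positive_seq_lyness_seq:
  assumes "as \<noteq> []" and "\<forall>r\<in>set as. r > 0"
  shows "positive_seq (lyness_seq as)"
proof -
  have "rev as ! i \<in> set as" if "i < length as" for i
    using that by (metis length_rev nth_mem set_rev)
  then show ?thesis
    using assms by (simp add: positive_seq_def lyness_seq_def)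
qed

lemma periodic_in_n_lyness_invariant:
  assumes "periodic_seq k a"
  shows "periodic_in_n k (lyness_invariant a)"
proof -
  have "lyness_numerator a (\<lambda>m. a (m + 1)) (n + k) x y = lyness_numerator a (\<lambda>m. a (m + 1)) n x y"
    if n: "n \<ge> 1" for n x y
  proof -
    have "a (n + (k + i)) = a (n + i)" for i
      using assms n unfolding periodic_seq_def by (metis add.assoc add.commute trans_le_add1)
    moreover from this[of 0] have "a (n + k) = a n"
      by simp
    ultimately show ?thesis
      by (simp only: lyness_numerator_def add.assoc)
  qed
  then show ?thesis
    using assms by (simp add: periodic_in_n_def periodic_seq_def lyness_invariant_def)
qed

text \<open>
  The factor \<open>r\<close> lets \<open>W\<close> be any normalisation of the invariant at time 1.
\<close>
lemma corresponding_first_integral_lyness_invariant: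
  assumes "as \<noteq> []" and "\<forall>r\<in>set as. r > 0" and "length as dvd 6" and "r \<noteq> 0"
    and W: "\<And>x y. x > 0 \<Longrightarrow> y > 0 \<Longrightarrow> lyness_invariant (lyness_seq as) x y 1 = r * W (x, y)"
  shows "corresponding_first_integral as W"
  unfolding corresponding_first_integral_def
proof (intro conjI allI impI)
  let ?a = "lyness_seq as"
  have a: "positive_seq ?a"
    using positive_seq_lyness_seq assms by blast
  have per: "periodic_seq (length as) ?a"
    using periodic_seq_lyness_seq assms by blast
  have per6: "periodic_seq 6 ?a"
    using periodic_seq_dvd[OF per assms(3)] by simp
  have V: "quartic_invariant ?a (lyness_invariant ?a)" "periodic_in_n (length as) (lyness_invariant ?a)"
    using quartic_invariant_lyness_invariant[OF a per6] periodic_in_n_lyness_invariant[OF per]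
    by blast+
  then show "\<exists>V. quartic_invariant ?a V \<and> periodic_in_n (length as) V"
    by blast
  show "first_integral (lyness_comp as) W"
    using first_integral_of_periodic_invariant[OF a _ V(2) W \<open>r \<noteq> 0\<close>] V(1)
    by (simp add: quartic_invariant_def)
  fix V
  assume "quartic_invariant ?a V \<and> periodic_in_n (length as) V"
  moreover from this have "periodic_in_n 6 V"
    using periodic_seq_dvd[OF _ assms(3)] unfolding periodic_in_n_def by force
  ultimately obtain c where "c \<noteq> 0" "\<forall>n\<ge>1. \<forall>x>0. \<forall>y>0. V x y n = c * lyness_invariant ?a x y n"
    using periodic_quartic_invariant_unique[OF a] by blast
  then show "\<exists>c. c \<noteq> 0 \<and> (\<forall>x>0. \<forall>y>0. V x y 1 = c * W (x, y))"
    using W \<open>r \<noteq> 0\<close> by (intro exI[of _ "c * r"]) simp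
qed

text \<open>
  Seven values are listed because the coefficient of \<open>x\<close> at time 1 is \<open>a\<^sub>7 + a\<^sub>2a\<^sub>6\<close>.
\<close>
lemma lyness_seq_values:
  "map (lyness_seq [a]) [1, 2, 3, 4, 5, 6, 7] = [a, a, a, a, a, a, a]"
  "map (lyness_seq [b, a]) [1, 2, 3, 4, 5, 6, 7] = [a, b, a, b, a, b, a]"
  "map (lyness_seq [c, b, a]) [1, 2, 3, 4, 5, 6, 7] = [a, b, c, a, b, c, a]"
  "map (lyness_seq [f, e, d, c, b, a]) [1, 2, 3, 4, 5, 6, 7] = [a, b, c, d, e, f, a]"
  unfolding lyness_seq_def by code_simp+

lemma lyness_invariant_1:
  assumes "map s [1, 2, 3, 4, 5, 6, 7] = [a, b, c, d, e, f, a]"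
  shows "lyness_invariant s x y 1 = (a * f + (a + b * f) * x + (f + a * e) * y + b * x^2 + e * y^2
    + c * x^2 * y + d * x * y^2) / (x * y)"
  using assms by (simp add: lyness_invariant_def lyness_numerator_def del: One_nat_def)

theorem corollary4:
  shows
    "(\<forall>k\<ge>1.
        (\<forall>a. positive_seq a \<and> primitive_period k a \<longrightarrow> (\<exists>V. quartic_invariant a V))
          \<longleftrightarrow> k \<in> {1, 2, 3, 6})
     \<and>
     (\<forall>k a. positive_seq a \<and> primitive_period k a \<and> (\<forall>n\<ge>1. a (n + 1) \<noteq> a n * a (n + 2)) \<longrightarrow>
        ((\<exists>V. quartic_invariant a V) \<longleftrightarrow> k \<in> {1, 2, 3, 6}))
     \<and>
     (\<forall>a b c d e f :: real. a > 0 \<and> b > 0 \<and> c > 0 \<and> d > 0 \<and> e > 0 \<and> f > 0 \<longrightarrow>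
        corresponding_first_integral [a]
          (\<lambda>(x, y). (a + (a + 1) * x + (a + 1) * y + x^2 + y^2 + x^2 * y + x * y^2) / (x * y)) \<and>
        corresponding_first_integral [b, a]
          (\<lambda>(x, y). (a * b + (a + b^2) * x + (b + a^2) * y + b * x^2 + a * y^2
                       + a * x^2 * y + b * x * y^2) / (x * y)) \<and>
        corresponding_first_integral [c, b, a]
          (\<lambda>(x, y). (a * c + (a + b * c) * x + (c + a * b) * y + b * x^2 + b * y^2
                       + c * x^2 * y + a * x * y^2) / (x * y)) \<and>
        corresponding_first_integral [f, e, d, c, b, a]
          (\<lambda>(x, y). (a * f + (a + b * f) * x + (f + a * e) * y + b * x^2 + e * y^2
                       + c * x^2 * y + d * x * y^2) / (x * y)))"
proof (intro conjI allI impI)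
  have nec: "k \<in> {1, 2, 3, 6}"
    if "positive_seq a" "primitive_period k a" "\<forall>n\<ge>1. a (n + 1) \<noteq> a n * a (n + 2)"
      "quartic_invariant a V" for k a V
    using that primitive_period_of_6_periodic quartic_invariant_generic_imp_period_6 by blast
  have suf: "\<exists>V. quartic_invariant a V"
    if "positive_seq a" "primitive_period k a" "k \<in> {1, 2, 3, 6}" for k a
  proof -
    have "k dvd 6"
      using that(3) by auto
    then have "periodic_seq 6 a"
      using that(2) periodic_seq_dvd[of k a 6] by (simp add: primitive_period_def)
    then show ?thesis
      using quartic_invariant_lyness_invariant[OF that(1)] by blast
  qed
  show "(\<forall>a. positive_seq a \<and> primitive_period k a \<longrightarrow> (\<exists>V. quartic_invariant a V))
          \<longleftrightarrow> k \<in> {1, 2, 3, 6}" if "k \<ge> 1" for k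
    using nec suf exists_generic_primitive_period[OF that] by metis
  show "(\<exists>V. quartic_invariant a V) \<longleftrightarrow> k \<in> {1, 2, 3, 6}"
    if "positive_seq a \<and> primitive_period k a \<and> (\<forall>n\<ge>1. a (n + 1) \<noteq> a n * a (n + 2))" for k a
    using nec suf that by blast
next
  fix a b c d e f :: real
  assume "a > 0 \<and> b > 0 \<and> c > 0 \<and> d > 0 \<and> e > 0 \<and> f > 0"
  then have pos: "a > 0" "b > 0" "c > 0" "d > 0" "e > 0" "f > 0" by auto
  have dvd: "length [b, a] dvd 6" "length [c, b, a] dvd 6" "length [f, e, d, c, b, a] dvd 6"
    by (simp_all only: list.size) presburger+
  show "corresponding_first_integral [a]
          (\<lambda>(x, y). (a + (a + 1) * x + (a + 1) * y + x^2 + y^2 + x^2 * y + x * y^2) / (x * y))"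
    by (rule corresponding_first_integral_lyness_invariant[where r = a])
      (use pos in \<open>auto simp: lyness_invariant_1[OF lyness_seq_values(1), unfolded One_nat_def] field_simps power2_eq_square\<close>)
  show "corresponding_first_integral [b, a]
          (\<lambda>(x, y). (a * b + (a + b^2) * x + (b + a^2) * y + b * x^2 + a * y^2
                       + a * x^2 * y + b * x * y^2) / (x * y))"
    by (rule corresponding_first_integral_lyness_invariant[OF _ _ dvd(1) one_neq_zero])
      (use pos in \<open>auto simp: lyness_invariant_1[OF lyness_seq_values(2), unfolded One_nat_def] power2_eq_square\<close>)
  show "corresponding_first_integral [c, b, a]
          (\<lambda>(x, y). (a * c + (a + b * c) * x + (c + a * b) * y + b * x^2 + b * y^2
                       + c * x^2 * y + a * x * y^2) / (x * y))"
    by (rule corresponding_first_integral_lyness_invariant[OF _ _ dvd(2) one_neq_zero])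
      (use pos in \<open>auto simp: lyness_invariant_1[OF lyness_seq_values(3), unfolded One_nat_def]\<close>)
  show "corresponding_first_integral [f, e, d, c, b, a]
          (\<lambda>(x, y). (a * f + (a + b * f) * x + (f + a * e) * y + b * x^2 + e * y^2
                       + c * x^2 * y + d * x * y^2) / (x * y))"
    by (rule corresponding_first_integral_lyness_invariant[OF _ _ dvd(3) one_neq_zero])
      (use pos in \<open>auto simp: lyness_invariant_1[OF lyness_seq_values(4), unfolded One_nat_def]\<close>)
qed

end
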